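(* Let $L$ be a bounded distributive lattice, $f\colon L^n\to L$ a polynomial function, and $\alpha\colon 2^{[n]}\to L$ a mapping. Then $\alpha\in\mathrm{DNF}(f)$ if and only if $\bigvee_{J\subseteq I}\alpha(J)=\alpha_f(I)$ for all $I\subseteq[n]$.
   Context: Here $n\geqslant 1$, $[n]=\{1,\ldots,n\}$, $2^{[n]}$ is the set of all subsets of $[n]$, and $0,1$ are the bottom and top elements of $L$. A polynomial function $f\colon L^n\to L$ is a map that can be obtained by composition of the binary operations $\wedge$ and $\vee$, the projections, and the constant functions. For a function $f\colon L^n\to L$, $\mathrm{DNF}(f)$ denotes the set of those maps $\alpha\colon 2^{[n]}\to L$ such that $f(x_1,\ldots,x_n)=\bigvee_{I\subseteq[n]}\big(\alpha(I)\wedge\bigwedge_{i\in I}x_i\big)$ for all $(x_1,\ldots,x_n)\in L^n$ (the empty meet being $1$). For $I\subseteq[n]$, $\mathbf{e}_I\in L^n$ is the tuple whose $i$th component is $1$ if $i\in I$ and $0$ otherwise, and $\alpha_f\colon 2^{[n]}\to L$ is defined by $\alpha_f(I)=f(\mathbf{e}_I)$. *)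

theory Defs
  imports "HOL-Analysis.Finite_Cartesian_Product"
begin

text \<open>
  The index set \<open>[n]\<close> is the universe of a finite type \<open>'n\<close> with \<open>CARD('n) = n\<close> (so that
  \<open>n \<ge> 1\<close>), \<open>L\<^sup>n\<close> is the type \<open>'a ^ 'n\<close>, and \<open>2\<^sup>[\<^sup>n\<^sup>]\<close> is the type \<open>'n set\<close>.
\<close>

inductive lattice_polynomial_function ::
    "('a::{distrib_lattice, bounded_lattice} ^ 'n::finite \<Rightarrow> 'a) \<Rightarrow> bool" where
  proj: "lattice_polynomial_function (\<lambda>x. x $ i)"
| const: "lattice_polynomial_function (\<lambda>x. c)"
| inf: "lattice_polynomial_function f \<Longrightarrow> lattice_polynomial_function g \<Longrightarrow>
    lattice_polynomial_function (\<lambda>x. inf (f x) (g x))"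
| sup: "lattice_polynomial_function f \<Longrightarrow> lattice_polynomial_function g \<Longrightarrow>
    lattice_polynomial_function (\<lambda>x. sup (f x) (g x))"

text \<open>\<^const>\<open>Inf_fin\<close> is unspecified on the empty set; inserting \<^const>\<open>top\<close> makes the empty meet \<^const>\<open>top\<close>.\<close>

definition meet_on :: "'n set \<Rightarrow> 'a::{distrib_lattice, bounded_lattice} ^ 'n::finite \<Rightarrow> 'a" where
  "meet_on I x = Inf_fin (insert top ((\<lambda>i. x $ i) ` I))"

definition DNF ::
    "('a::{distrib_lattice, bounded_lattice} ^ 'n::finite \<Rightarrow> 'a) \<Rightarrow> ('n set \<Rightarrow> 'a) set" where
  "DNF f = {\<alpha>. \<forall>x. f x = Sup_fin ((\<lambda>I. inf (\<alpha> I) (meet_on I x)) ` Pow UNIV)}"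

definition char_vec :: "'n set \<Rightarrow> 'a::{distrib_lattice, bounded_lattice} ^ 'n::finite" where
  "char_vec I = (\<chi> i. if i \<in> I then top else bot)"

definition alpha_of ::
    "('a::{distrib_lattice, bounded_lattice} ^ 'n::finite \<Rightarrow> 'a) \<Rightarrow> 'n set \<Rightarrow> 'a" where
  "alpha_of f I = f (char_vec I)"

end

theory Submission
  imports Defs
begin

text \<open>
  A polynomial function is monotone and satisfies Goodstein's formula: it is the join of
  the terms \<open>f(\<^bold>e\<^sub>I) \<and> \<And>\<^bsub>i \<in> I\<^esub> x\<^sub>i\<close>, so it is determined by its values at
  the vectors \<open>\<^bold>e\<^sub>I\<close>. Conversely, evaluating the disjunctive normal form given by \<open>\<alpha>\<close> at
  \<open>\<^bold>e\<^sub>I\<close> keeps exactly the \<open>\<alpha>(J)\<close> with \<open>J \<subseteq> I\<close>. Since meets decrease when the index set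
  grows, \<open>\<alpha>\<close> and its monotone hull \<open>I \<mapsto> \<Or>\<^bsub>J \<subseteq> I\<^esub> \<alpha>(J)\<close> give the same normal form.
\<close>

text \<open>The universal property of a finite meet; the order facts on \<open>meet_on\<close> below
  follow from it without unfolding \<open>Inf_fin\<close>.\<close>

lemma le_meet_on_iff: "z \<le> meet_on I x \<longleftrightarrow> (\<forall>i\<in>I. z \<le> x $ i)"
  unfolding meet_on_def by (subst Inf_fin.bounded_iff) auto

lemma meet_on_le: "i \<in> I \<Longrightarrow> meet_on I x \<le> x $ i"
  using le_meet_on_iff by blast

lemma meet_on_antimono: "J \<subseteq> I \<Longrightarrow> meet_on I x \<le> meet_on J x"
  unfolding le_meet_on_iff by (blast intro: meet_on_le)

lemma meet_on_Un: "meet_on (I \<union> J) x = inf (meet_on I x) (meet_on J x)"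
proof (rule order.antisym)
  show "meet_on (I \<union> J) x \<le> inf (meet_on I x) (meet_on J x)"
    by (simp add: meet_on_antimono)
  show "inf (meet_on I x) (meet_on J x) \<le> meet_on (I \<union> J) x"
    unfolding le_meet_on_iff by (blast intro: le_infI1 le_infI2 meet_on_le)
qed

lemma meet_on_empty: "meet_on {} x = top"
  by (simp add: meet_on_def)

lemma meet_on_singleton: "meet_on {i} x = x $ i"
  by (simp add: meet_on_def)

lemma meet_on_char_vec:
  fixes I J :: "'n::finite set"
  shows "meet_on J (char_vec I :: 'a::{distrib_lattice, bounded_lattice} ^ 'n) =
    (if J \<subseteq> I then top else bot)"
proof (cases "J \<subseteq> I")
  case True
  then have "top \<le> meet_on J (char_vec I :: 'a ^ 'n)"
    unfolding le_meet_on_iff by (auto simp: char_vec_def)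
  then show ?thesis using True by (simp add: top_unique)
next
  case False
  then obtain i where "i \<in> J" "i \<notin> I" by blast
  then have "meet_on J (char_vec I :: 'a ^ 'n) \<le> bot"
    using meet_on_le[of i J "char_vec I :: 'a ^ 'n"] by (simp add: char_vec_def)
  then show ?thesis using False by (simp add: bot_unique)
qed

lemma char_vec_mono:
  "J \<subseteq> I \<Longrightarrow> (char_vec J :: 'a::{distrib_lattice, bounded_lattice} ^ 'n::finite) $ i \<le> char_vec I $ i"
  by (auto simp: char_vec_def)

lemma lattice_polynomial_function_mono:
  assumes "lattice_polynomial_function f" "\<And>i. x $ i \<le> y $ i"
  shows "f x \<le> f y"
  using assms
proof (induction rule: lattice_polynomial_function.induct)
  case (inf f g)
  then show ?case by (intro inf_mono) auto
next
  case (sup f g)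
  then show ?case by (intro sup_mono) auto
qed auto

lemma alpha_of_mono:
  "lattice_polynomial_function f \<Longrightarrow> J \<subseteq> I \<Longrightarrow> alpha_of f J \<le> alpha_of f I"
  unfolding alpha_of_def by (erule lattice_polynomial_function_mono) (rule char_vec_mono)

text \<open>The easy half of Goodstein's formula. In the induction, a meet uses
  \<open>meet_on I x\<close> twice by idempotence, and a join is split by distributivity.\<close>

lemma alpha_of_inf_meet_on_le:
  assumes "lattice_polynomial_function f"
  shows "inf (alpha_of f I) (meet_on I x) \<le> f x"
  using assms
proof (induction rule: lattice_polynomial_function.induct)
  case (proj i)
  then show ?case by (auto simp: alpha_of_def char_vec_def meet_on_le)
next
  case (const c)
  then show ?case by (simp add: alpha_of_def)
next
  case (inf f g)
  have "inf (alpha_of (\<lambda>x. inf (f x) (g x)) I) (meet_on I x) =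
      inf (inf (alpha_of f I) (meet_on I x)) (inf (alpha_of g I) (meet_on I x))"
    by (simp add: alpha_of_def ac_simps)
  also have "\<dots> \<le> inf (f x) (g x)" using inf.IH by (rule inf_mono)
  finally show ?case .
next
  case (sup f g)
  from sup.IH show ?case unfolding alpha_of_def inf_sup_distrib2 by (rule sup_mono)
qed

text \<open>The parameter \<open>w\<close> makes the induction pass through meets without distributing joins.\<close>

lemma inf_lattice_polynomial_function_leI:
  assumes "lattice_polynomial_function f"
    and "\<And>I. inf w (inf (alpha_of f I) (meet_on I x)) \<le> z"
  shows "inf w (f x) \<le> z"
  using assms
proof (induction arbitrary: w rule: lattice_polynomial_function.induct)
  case (proj i)
  \<comment> \<open>The term at \<open>{i}\<close> is exactly \<open>x $ i\<close>; for a constant,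
    the empty set serves because the empty meet is \<open>top\<close>.\<close>
  from proj[of "{i}"] show ?case by (simp add: alpha_of_def char_vec_def meet_on_singleton)
next
  case (const c)
  from const[of "{}"] show ?case by (simp add: alpha_of_def meet_on_empty)
next
  case (inf f g)
  \<comment> \<open>First \<open>f x\<close> is absorbed into the parameter to expand
    \<open>g x\<close>, then a term of \<open>g\<close> is absorbed to expand \<open>f x\<close>.
    Only pairs of terms remain.\<close>
  have "inf (inf w (f x)) (g x) \<le> z"
  proof (rule inf.IH(2))
    fix J
    have "inf (inf w (inf (alpha_of g J) (meet_on J x))) (f x) \<le> z"
    proof (rule inf.IH(1))
      fix I
      \<comment> \<open>By monotonicity, the meet of the terms at \<open>I\<close> and
        \<open>J\<close> lies below the term of the meet function at
        \<open>I \<union> J\<close>.\<close>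
      have "inf (alpha_of f I) (alpha_of g J) \<le> alpha_of (\<lambda>x. inf (f x) (g x)) (I \<union> J)"
        using alpha_of_mono[OF inf.hyps(1), of I "I \<union> J"]
          alpha_of_mono[OF inf.hyps(2), of J "I \<union> J"]
        unfolding alpha_of_def by (intro inf_mono) auto
      then have "inf w (inf (inf (alpha_of f I) (alpha_of g J)) (meet_on (I \<union> J) x)) \<le> z"
        by (intro order_trans[OF _ inf.prems[of "I \<union> J"]] inf_mono) auto
      then show "inf (inf w (inf (alpha_of g J) (meet_on J x)))
          (inf (alpha_of f I) (meet_on I x)) \<le> z"
        by (simp add: meet_on_Un ac_simps)
    qed
    then show "inf (inf w (f x)) (inf (alpha_of g J) (meet_on J x)) \<le> z"
      by (simp add: ac_simps)
  qed
  then show ?case by (simp add: ac_simps)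
next
  case (sup f g)
  have "inf w (inf (alpha_of f I) (meet_on I x)) \<le> z"
    and "inf w (inf (alpha_of g I) (meet_on I x)) \<le> z" for I
    using sup.prems[of I] by (auto simp: alpha_of_def inf_sup_distrib1 inf_sup_distrib2)
  then show ?case using sup.IH by (auto simp: inf_sup_distrib1)
qed

text \<open>Goodstein's formula in terms of upper bounds: \<open>f x\<close> and the join of the
  terms have the same ones.\<close>

theorem lattice_polynomial_function_le_iff:
  assumes "lattice_polynomial_function f"
  shows "f x \<le> z \<longleftrightarrow> (\<forall>I. inf (alpha_of f I) (meet_on I x) \<le> z)"
proof
  assume "f x \<le> z"
  then show "\<forall>I. inf (alpha_of f I) (meet_on I x) \<le> z"
    by (blast intro: order_trans[OF alpha_of_inf_meet_on_le[OF assms]])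
next
  assume "\<forall>I. inf (alpha_of f I) (meet_on I x) \<le> z"
  then show "f x \<le> z"
    using inf_lattice_polynomial_function_leI[OF assms, of top x z] by simp
qed

lemma Sup_fin_image_Pow_le_iff:
  fixes \<alpha> :: "'n::finite set \<Rightarrow> 'a::lattice"
  shows "Sup_fin (\<alpha> ` Pow I) \<le> z \<longleftrightarrow> (\<forall>J\<subseteq>I. \<alpha> J \<le> z)"
  by (subst Sup_fin.bounded_iff) auto

text \<open>In a partial order an element is determined by its upper bounds, so equations with joins
  reduce to comparing bounds.\<close>

lemma eq_Sup_fin_image_Pow_iff:
  fixes \<alpha> :: "'n::finite set \<Rightarrow> 'a::lattice"
  shows "u = Sup_fin (\<alpha> ` Pow I) \<longleftrightarrow> (\<forall>z. u \<le> z \<longleftrightarrow> (\<forall>J\<subseteq>I. \<alpha> J \<le> z))"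
proof -
  have "u = v \<longleftrightarrow> (\<forall>z. u \<le> z \<longleftrightarrow> v \<le> z)" for v
    by (metis order.antisym order_refl)
  then show ?thesis by (simp only: Sup_fin_image_Pow_le_iff)
qed

theorem proposition3:
  fixes f :: "'a::{distrib_lattice, bounded_lattice} ^ 'n::finite \<Rightarrow> 'a"
    and \<alpha> :: "'n set \<Rightarrow> 'a"
  assumes "lattice_polynomial_function f"
  shows "\<alpha> \<in> DNF f \<longleftrightarrow> (\<forall>I. Sup_fin (\<alpha> ` Pow I) = alpha_of f I)"
proof
  assume "\<alpha> \<in> DNF f"
  then have *: "f x \<le> z \<longleftrightarrow> (\<forall>J. inf (\<alpha> J) (meet_on J x) \<le> z)" for x z
    unfolding DNF_def mem_Collect_eq eq_Sup_fin_image_Pow_iff by simp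
  have "alpha_of f I = Sup_fin (\<alpha> ` Pow I)" for I
    \<comment> \<open>At \<open>char_vec I\<close> the terms with \<open>J\<close> not inside
      \<open>I\<close> become \<open>bot\<close> and impose no condition on
      \<open>z\<close>.\<close>
    by (auto simp: eq_Sup_fin_image_Pow_iff alpha_of_def * meet_on_char_vec)
  then show "\<forall>I. Sup_fin (\<alpha> ` Pow I) = alpha_of f I" by simp
next
  assume "\<forall>I. Sup_fin (\<alpha> ` Pow I) = alpha_of f I"
  then have hull: "alpha_of f I = Sup_fin (\<alpha> ` Pow I)" for I by simp
  then have le: "\<alpha> J \<le> alpha_of f I" if "J \<subseteq> I" for I J
    using that Sup_fin_image_Pow_le_iff[of \<alpha> I "alpha_of f I"] by simp
  have "f x \<le> z \<longleftrightarrow> (\<forall>J. inf (\<alpha> J) (meet_on J x) \<le> z)" for x z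
  proof
    assume "f x \<le> z"
    then have "inf (alpha_of f J) (meet_on J x) \<le> z" for J
      by (simp add: lattice_polynomial_function_le_iff[OF assms])
    then show "\<forall>J. inf (\<alpha> J) (meet_on J x) \<le> z"
      by (meson inf_mono le order_refl order_trans)
  next
    assume J: "\<forall>J. inf (\<alpha> J) (meet_on J x) \<le> z"
    have "inf (alpha_of f I) (meet_on I x) \<le> z" for I
    proof -
      \<comment> \<open>Enlarging \<open>J\<close> to \<open>I\<close> only shrinks the meet, so the
        bound at \<open>J\<close> carries over.\<close>
      have "inf (\<alpha> J) (meet_on I x) \<le> z" if "J \<subseteq> I" for J
        using J that by (meson inf_mono meet_on_antimono order_refl order_trans)
      moreover have "inf (alpha_of f I) (meet_on I x) =
          Sup_fin ((\<lambda>J. inf (\<alpha> J) (meet_on I x)) ` Pow I)"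
        unfolding hull inf_commute[of _ "meet_on I x"]
        by (subst inf_Sup1_distrib) (auto intro: arg_cong[where f = Sup_fin])
      ultimately show ?thesis by (simp add: Sup_fin_image_Pow_le_iff)
    qed
    then show "f x \<le> z" by (simp add: lattice_polynomial_function_le_iff[OF assms])
  qed
  then show "\<alpha> \<in> DNF f"
    unfolding DNF_def mem_Collect_eq eq_Sup_fin_image_Pow_iff by simp
qed

end
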